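(* Consider the feedback connection of two discrete-time systems $\Sigma_1,\Sigma_2$, given by $u_1[k]=r_1[k]-y_2[k]$ and $u_2[k]=r_2[k]+y_1[k]$. Suppose that $\Sigma_1$ is $N_1$-step strongly detectable, satisfying $$\sum_{k=k_0}^{k_0+N_1}\vartheta_1|u_1[k]|^2+|y_1[k]|^2\ge p_1(x_1[k_0]),\quad\forall k_0\in\mathbb{Z}_{\ge0},$$ and $\Sigma_2$ is $N_2$-step strongly detectable, satisfying $$\sum_{k=k_0}^{k_0+N_2}\vartheta_2|u_2[k]|^2+|y_2[k]|^2\ge p_2(x_2[k_0]),\quad\forall k_0\in\mathbb{Z}_{\ge0},$$ where $\vartheta_1,\vartheta_2\ge0$ and $p_1,p_2$ are radially unbounded, positive definite functions. Then the feedback-connected system is $N$-step strongly detectable with respect to the input $r=(r_1^\top,r_2^\top)^\top$ and the output $y=(y_1^\top,y_2^\top)^\top$, that is, $\sum_{k=k_0}^{k_0+N}\vartheta|r[k]|^2+|y[k]|^2\ge p(x[k_0])$ for all $k_0$, where $x=(x_1^\top,x_2^\top)^\top$, $N=\max\{N_1,N_2\}$, $p(x)=(1-\vartheta)(p_1(x_1)+p_2(x_2))$ and $$\vartheta=\max\left\{\frac{2\vartheta_1}{2\vartheta_1+1},\frac{2\vartheta_2}{2\vartheta_2+1}\right\}.$$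
   Context: $|\cdot|$ is the Euclidean norm. A discrete-time control system is $x[k+1]=f_d(x[k],u[k])$, $y[k]=h_d(x[k],u[k])$, $k\in\mathbb{Z}_{\ge0}$, with $f_d,h_d$ continuous, state in $\mathbb{R}^n$, and input and output of the same dimension $m$. $\Sigma_i$ has state $x_i$, input $u_i$, output $y_i$. A discrete-time system is $N$-step strongly detectable (SD), $N\in\mathbb{Z}_{\ge0}$, if there exist a constant $\vartheta\ge0$ and a radially unbounded, positive definite function $p:\mathbb{R}^n\to\mathbb{R}_{\ge0}$ such that for any $k_0\in\mathbb{Z}_{\ge0}$, any initial state $x[k_0]\in\mathbb{R}^n$ and any admissible input $u[k]$, $\sum_{k=k_0}^{k_0+N}\vartheta|u[k]|^2+|y[k]|^2\ge p(x[k_0])$. *)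

theory Defs
  imports "HOL-Analysis.Analysis"
begin

text \<open>
  A system is identified with its set of trajectories: \<open>B k0 x u y\<close> says that the state,
  input and output sequences \<open>x\<close>, \<open>u\<close>, \<open>y\<close> form a trajectory of the system that is started at
  time \<open>k0\<close>. Values before \<open>k0\<close> are irrelevant. A relation rather than a pair of maps is
  used because a feedback loop of two systems with direct feedthrough contains an algebraic loop
  and need not have the explicit form \<open>x[k+1] = F (x[k], r[k])\<close>, \<open>y[k] = H (x[k], r[k])\<close>.
\<close>

type_synonym ('x, 'u, 'y) dt_system =
  "nat \<Rightarrow> (nat \<Rightarrow> 'x) \<Rightarrow> (nat \<Rightarrow> 'u) \<Rightarrow> (nat \<Rightarrow> 'y) \<Rightarrow> bool"

text \<open>
  \<open>U\<close> is the class of admissible input sequences, \<open>UNIV\<close> if there is no restriction. For every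
  \<open>k0\<close>, every initial state and every \<open>u \<in> U\<close> there is a trajectory, unique from \<open>k0\<close> on.
\<close>

definition state_space ::
  "('x \<times> 'u \<Rightarrow> 'x) \<Rightarrow> ('x \<times> 'u \<Rightarrow> 'y) \<Rightarrow> (nat \<Rightarrow> 'u) set \<Rightarrow> ('x, 'u, 'y) dt_system" where
  "state_space f h U k0 x u y \<longleftrightarrow>
     u \<in> U \<and> (\<forall>k\<ge>k0. x (Suc k) = f (x k, u k) \<and> y k = h (x k, u k))"

text \<open>
  Stacked vectors such as \<open>(x\<^sub>1\<^sup>T, x\<^sub>2\<^sup>T)\<^sup>T\<close> are pairs; the norm of the product type is the
  Euclidean one, \<open>norm (a, b) = sqrt ((norm a)\<^sup>2 + (norm b)\<^sup>2)\<close>. No well-posedness of the loop is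
  required: all solutions of the loop equations with admissible \<open>u1\<close>, \<open>u2\<close> are trajectories.
\<close>

definition feedback ::
  "('x1, 'u, 'u) dt_system \<Rightarrow> ('x2, 'u, 'u) dt_system \<Rightarrow>
   ('x1 \<times> 'x2, 'u \<times> 'u, 'u \<times> 'u :: ab_group_add) dt_system" where
  "feedback S1 S2 k0 x r y \<longleftrightarrow>
     (\<exists>u1 u2. S1 k0 (\<lambda>k. fst (x k)) u1 (\<lambda>k. fst (y k)) \<and>
              S2 k0 (\<lambda>k. snd (x k)) u2 (\<lambda>k. snd (y k)) \<and>
              (\<forall>k\<ge>k0. u1 k = fst (r k) - snd (y k) \<and> u2 k = snd (r k) + fst (y k)))"

definition positive_definite :: "('x::real_normed_vector \<Rightarrow> real) \<Rightarrow> bool" where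
  "positive_definite p \<longleftrightarrow> p 0 = 0 \<and> (\<forall>x. x \<noteq> 0 \<longrightarrow> p x > 0)"

definition radially_unbounded :: "('x::real_normed_vector \<Rightarrow> real) \<Rightarrow> bool" where
  "radially_unbounded p \<longleftrightarrow> filterlim p at_top at_infinity"

definition strongly_detectable_with ::
  "('x::euclidean_space, 'u::euclidean_space, 'y::euclidean_space) dt_system \<Rightarrow>
   nat \<Rightarrow> real \<Rightarrow> ('x \<Rightarrow> real) \<Rightarrow> bool" where
  "strongly_detectable_with S N \<theta> p \<longleftrightarrow>
     \<theta> \<ge> 0 \<and> radially_unbounded p \<and> positive_definite p \<and>
     (\<forall>k0 x u y. S k0 x u y \<longrightarrow>
        (\<Sum>k = k0..k0 + N. \<theta> * (norm (u k))\<^sup>2 + (norm (y k))\<^sup>2) \<ge> p (x k0))"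

definition strongly_detectable ::
  "('x::euclidean_space, 'u::euclidean_space, 'y::euclidean_space) dt_system \<Rightarrow> nat \<Rightarrow> bool" where
  "strongly_detectable S N \<longleftrightarrow> (\<exists>\<theta> p. strongly_detectable_with S N \<theta> p)"

end

theory Submission imports Defs begin

text \<open>
  Write \<open>c = 1 - \<theta>\<close>. The loop equations give \<open>|u\<^sub>1|\<^sup>2 \<le> 2|r\<^sub>1|\<^sup>2 + 2|y\<^sub>2|\<^sup>2\<close> and
  \<open>|u\<^sub>2|\<^sup>2 \<le> 2|r\<^sub>2|\<^sup>2 + 2|y\<^sub>1|\<^sup>2\<close>. The value \<open>2\<theta>\<^sub>i / (2\<theta>\<^sub>i + 1)\<close> is the solution \<open>t\<close> of
  \<open>(1 - t) 2\<theta>\<^sub>i = t\<close>, so \<open>\<theta>\<close>, being at least as large, satisfies \<open>c \<cdot> 2\<theta>\<^sub>i \<le> \<theta>\<close> for both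
  \<open>i\<close>. Hence at each time
  \<open>c (\<theta>\<^sub>1|u\<^sub>1|\<^sup>2 + |y\<^sub>1|\<^sup>2 + \<theta>\<^sub>2|u\<^sub>2|\<^sup>2 + |y\<^sub>2|\<^sup>2) \<le> \<theta>|r|\<^sup>2 + (\<theta> + c)|y|\<^sup>2 = \<theta>|r|\<^sup>2 + |y|\<^sup>2\<close>:
  what feedback turns from output into input is exactly what the factor \<open>c\<close> leaves free
  (\<open>feedback_supply_bound\<close>). Summing over the longer of the two windows and inserting the two
  detectability inequalities gives the bound by \<open>p\<close>. Since \<open>\<theta> < 1\<close>, the factor \<open>c\<close> is positive,
  and \<open>p\<close> inherits positive definiteness and radial unboundedness from \<open>p\<^sub>1\<close> and \<open>p\<^sub>2\<close>.

  This is an argument about trajectories, and \<open>feedback_strongly_detectable_with\<close> states it for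
  systems given by arbitrary trajectory relations.
\<close>

lemma positive_definite_nonneg:
  assumes "positive_definite p"
  shows "0 \<le> p x"
  using assms by (cases "x = 0") (auto simp: positive_definite_def intro: less_imp_le)

lemma positive_definite_scaled_sum:
  fixes p :: "'a::real_normed_vector \<Rightarrow> real" and q :: "'b::real_normed_vector \<Rightarrow> real"
  assumes p: "positive_definite p" and q: "positive_definite q" and c: "0 < c"
  shows "positive_definite (\<lambda>x. c * (p (fst x) + q (snd x)))"
proof -
  have "0 < p (fst x) + q (snd x)" if "x \<noteq> 0" for x
  proof (cases "fst x = 0")
    case True
    with that have "snd x \<noteq> 0" by (simp add: prod_eq_iff)
    then show ?thesis
      using q positive_definite_nonneg[OF p, of "fst x"]
      by (simp add: positive_definite_def add_nonneg_pos)
  next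
    case False
    then show ?thesis
      using p positive_definite_nonneg[OF q, of "snd x"]
      by (simp add: positive_definite_def add_pos_nonneg)
  qed
  then show ?thesis
    using p q c by (auto simp: positive_definite_def)
qed

text \<open>
  A large pair has a large component, and the summand of the other component cannot cancel the
  growth because it is nonnegative.
\<close>

lemma radially_unbounded_scaled_sum:
  fixes p :: "'a::real_normed_vector \<Rightarrow> real" and q :: "'b::real_normed_vector \<Rightarrow> real"
  assumes p: "radially_unbounded p" "\<And>x. 0 \<le> p x"
    and q: "radially_unbounded q" "\<And>x. 0 \<le> q x"
    and c: "0 < c"
  shows "radially_unbounded (\<lambda>x. c * (p (fst x) + q (snd x)))"
  unfolding radially_unbounded_def filterlim_at_top eventually_at_infinity
proof
  fix Z :: real
  obtain a where a: "\<And>x. a \<le> norm x \<Longrightarrow> Z / c \<le> p x"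
    using p(1) unfolding radially_unbounded_def filterlim_at_top eventually_at_infinity by meson
  obtain b where b: "\<And>x. b \<le> norm x \<Longrightarrow> Z / c \<le> q x"
    using q(1) unfolding radially_unbounded_def filterlim_at_top eventually_at_infinity by meson
  have "Z \<le> c * (p (fst x) + q (snd x))" if "a + b \<le> norm x" for x
  proof -
    have "norm x \<le> norm (fst x) + norm (snd x)"
      using norm_Pair_le[of "fst x" "snd x"] by simp
    with that consider "a \<le> norm (fst x)" | "b \<le> norm (snd x)" by linarith
    then have "Z / c \<le> p (fst x) + q (snd x)"
    proof cases
      case 1
      with a[of "fst x"] q(2)[of "snd x"] show ?thesis by linarith
    next
      case 2
      with b[of "snd x"] p(2)[of "fst x"] show ?thesis by linarith
    qed
    then show ?thesis using c by (simp add: pos_divide_le_eq mult.commute)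
  qed
  then show "\<exists>B. \<forall>x. B \<le> norm x \<longrightarrow> Z \<le> c * (p (fst x) + q (snd x))" by blast
qed

lemma norm_add_power2_le:
  fixes a b :: "'a::real_inner"
  shows "(norm (a + b))\<^sup>2 \<le> 2 * (norm a)\<^sup>2 + 2 * (norm b)\<^sup>2"
proof -
  have "(norm (a + b))\<^sup>2 + (norm (a - b))\<^sup>2 = 2 * (norm a)\<^sup>2 + 2 * (norm b)\<^sup>2"
    by (simp add: power2_norm_eq_inner inner_simps inner_commute)
  then show ?thesis using zero_le_power2[of "norm (a - b)"] by linarith
qed

lemma norm_diff_power2_le:
  fixes a b :: "'a::real_inner"
  shows "(norm (a - b))\<^sup>2 \<le> 2 * (norm a)\<^sup>2 + 2 * (norm b)\<^sup>2"
  using norm_add_power2_le[of a "- b"] by simp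

lemma norm_prod_power2: "(norm x)\<^sup>2 = (norm (fst x))\<^sup>2 + (norm (snd x))\<^sup>2"
  by (simp add: norm_prod_def)

text \<open>
  The map \<open>t \<mapsto> 2t / (2t + 1)\<close> is the inverse of \<open>s \<mapsto> s / (2(1 - s))\<close>, and the latter is increasing
  on \<open>s < 1\<close>. For \<open>\<theta> \<ge> 1\<close> the left-hand side is not positive.
\<close>

lemma feedback_gain_bound:
  fixes t \<theta> :: real
  assumes "0 \<le> t" "2 * t / (2 * t + 1) \<le> \<theta>"
  shows "(1 - \<theta>) * t \<le> \<theta> / 2"
proof -
  have "2 * t \<le> \<theta> * (2 * t + 1)"
    using assms by (simp add: pos_divide_le_eq)
  then show ?thesis by (simp add: algebra_simps)
qed

text \<open>
  The factor 2 lost in splitting the squared norms of \<open>r1 - y2\<close> and \<open>r2 + y1\<close> is the reason for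
  the bounds \<open>\<theta> / 2\<close> in the hypotheses.
\<close>

lemma feedback_supply_bound:
  fixes r1 r2 y1 y2 :: "'a::real_inner"
  assumes t1: "(1 - \<theta>) * t1 \<le> \<theta> / 2" and t2: "(1 - \<theta>) * t2 \<le> \<theta> / 2" and "0 \<le> \<theta>"
  shows "(1 - \<theta>) * ((t1 * (norm (r1 - y2))\<^sup>2 + (norm y1)\<^sup>2) + (t2 * (norm (r2 + y1))\<^sup>2 + (norm y2)\<^sup>2))
    \<le> \<theta> * ((norm r1)\<^sup>2 + (norm r2)\<^sup>2) + ((norm y1)\<^sup>2 + (norm y2)\<^sup>2)"
proof -
  have "(1 - \<theta>) * t1 * (norm (r1 - y2))\<^sup>2 \<le> \<theta> / 2 * (2 * (norm r1)\<^sup>2 + 2 * (norm y2)\<^sup>2)"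
    using t1 norm_diff_power2_le \<open>0 \<le> \<theta>\<close> by (intro mult_mono) auto
  moreover have "(1 - \<theta>) * t2 * (norm (r2 + y1))\<^sup>2 \<le> \<theta> / 2 * (2 * (norm r2)\<^sup>2 + 2 * (norm y1)\<^sup>2)"
    using t2 norm_add_power2_le \<open>0 \<le> \<theta>\<close> by (intro mult_mono) auto
  ultimately show ?thesis by (simp add: algebra_simps)
qed

text \<open>
  The summands are nonnegative, so a detectability inequality survives the passage to a longer
  window.
\<close>

lemma strongly_detectable_with_mono_steps:
  assumes S: "strongly_detectable_with S N \<theta> p" and "N \<le> M"
  shows "strongly_detectable_with S M \<theta> p"
proof -
  have "(\<Sum>k = k0..k0 + N. \<theta> * (norm (u k))\<^sup>2 + (norm (y k))\<^sup>2)
      \<le> (\<Sum>k = k0..k0 + M. \<theta> * (norm (u k))\<^sup>2 + (norm (y k))\<^sup>2)" for k0 u y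
    using assms by (intro sum_mono2) (auto simp: strongly_detectable_with_def)
  then show ?thesis
    using S unfolding strongly_detectable_with_def by (blast intro: order_trans)
qed

theorem feedback_strongly_detectable_with:
  fixes S1 :: "('x1::euclidean_space, 'u::euclidean_space, 'u) dt_system"
    and S2 :: "('x2::euclidean_space, 'u, 'u) dt_system"
  assumes S1: "strongly_detectable_with S1 N1 \<theta>1 p1"
    and S2: "strongly_detectable_with S2 N2 \<theta>2 p2"
    and \<theta>_def: "\<theta> = max (2 * \<theta>1 / (2 * \<theta>1 + 1)) (2 * \<theta>2 / (2 * \<theta>2 + 1))"
  shows "strongly_detectable_with (feedback S1 S2) (max N1 N2) \<theta>
    (\<lambda>x. (1 - \<theta>) * (p1 (fst x) + p2 (snd x)))"
proof -
  let ?N = "max N1 N2"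
  have nonneg: "0 \<le> \<theta>1" "0 \<le> \<theta>2"
    using S1 S2 by (auto simp: strongly_detectable_with_def)
  then have \<theta>: "0 \<le> \<theta>" "\<theta> < 1"
    unfolding \<theta>_def by (auto simp: le_max_iff_disj pos_divide_less_eq)
  have gain: "(1 - \<theta>) * \<theta>1 \<le> \<theta> / 2" "(1 - \<theta>) * \<theta>2 \<le> \<theta> / 2"
    using nonneg by (intro feedback_gain_bound; simp add: \<theta>_def)+
  have p1: "radially_unbounded p1" "positive_definite p1"
    and p2: "radially_unbounded p2" "positive_definite p2"
    using S1 S2 by (auto simp: strongly_detectable_with_def)
  have "(1 - \<theta>) * (p1 (fst (x k0)) + p2 (snd (x k0)))
      \<le> (\<Sum>k = k0..k0 + ?N. \<theta> * (norm (r k))\<^sup>2 + (norm (y k))\<^sup>2)"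
    if "feedback S1 S2 k0 x r y" for k0 x r y
  proof -
    obtain u1 u2 where
      tr: "S1 k0 (\<lambda>k. fst (x k)) u1 (\<lambda>k. fst (y k))" "S2 k0 (\<lambda>k. snd (x k)) u2 (\<lambda>k. snd (y k))"
      and loop: "\<And>k. k \<ge> k0 \<Longrightarrow> u1 k = fst (r k) - snd (y k) \<and> u2 k = snd (r k) + fst (y k)"
      using \<open>feedback S1 S2 k0 x r y\<close> unfolding feedback_def by blast
    let ?s1 = "\<lambda>k. \<theta>1 * (norm (u1 k))\<^sup>2 + (norm (fst (y k)))\<^sup>2"
    let ?s2 = "\<lambda>k. \<theta>2 * (norm (u2 k))\<^sup>2 + (norm (snd (y k)))\<^sup>2"
    have "p1 (fst (x k0)) \<le> (\<Sum>k = k0..k0 + ?N. ?s1 k)"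
      using strongly_detectable_with_mono_steps[OF S1 max.cobounded1] tr(1)
      unfolding strongly_detectable_with_def by blast
    moreover have "p2 (snd (x k0)) \<le> (\<Sum>k = k0..k0 + ?N. ?s2 k)"
      using strongly_detectable_with_mono_steps[OF S2 max.cobounded2] tr(2)
      unfolding strongly_detectable_with_def by blast
    ultimately have "(1 - \<theta>) * (p1 (fst (x k0)) + p2 (snd (x k0)))
        \<le> (1 - \<theta>) * ((\<Sum>k = k0..k0 + ?N. ?s1 k) + (\<Sum>k = k0..k0 + ?N. ?s2 k))"
      using \<theta> by (intro mult_left_mono add_mono) auto
    also have "\<dots> = (\<Sum>k = k0..k0 + ?N. (1 - \<theta>) * (?s1 k + ?s2 k))"
      by (simp only: sum.distrib[symmetric] sum_distrib_left)
    also have "\<dots> \<le> (\<Sum>k = k0..k0 + ?N. \<theta> * (norm (r k))\<^sup>2 + (norm (y k))\<^sup>2)"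
    proof (rule sum_mono)
      fix k assume "k \<in> {k0..k0 + ?N}"
      then have u: "u1 k = fst (r k) - snd (y k)" "u2 k = snd (r k) + fst (y k)"
        using loop by auto
      show "(1 - \<theta>) * (?s1 k + ?s2 k) \<le> \<theta> * (norm (r k))\<^sup>2 + (norm (y k))\<^sup>2"
        unfolding u norm_prod_power2[of "r k"] norm_prod_power2[of "y k"]
        by (rule feedback_supply_bound[OF gain \<theta>(1)])
    qed
    finally show ?thesis .
  qed
  then show ?thesis
    unfolding strongly_detectable_with_def
    using \<theta> p1 p2 positive_definite_nonneg[OF p1(2)] positive_definite_nonneg[OF p2(2)]
    by (simp add: radially_unbounded_scaled_sum positive_definite_scaled_sum)
qed

theorem lemma3:
  fixes f1 :: "(real ^ 'n1) \<times> (real ^ 'm) \<Rightarrow> real ^ 'n1"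
    and h1 :: "(real ^ 'n1) \<times> (real ^ 'm) \<Rightarrow> real ^ 'm"
    and f2 :: "(real ^ 'n2) \<times> (real ^ 'm) \<Rightarrow> real ^ 'n2"
    and h2 :: "(real ^ 'n2) \<times> (real ^ 'm) \<Rightarrow> real ^ 'm"
    and U1 U2 :: "(nat \<Rightarrow> real ^ 'm) set"
    and N1 N2 N :: nat
    and \<theta>1 \<theta>2 \<theta> :: real
    and p1 :: "real ^ 'n1 \<Rightarrow> real"
    and p2 :: "real ^ 'n2 \<Rightarrow> real"
    and p :: "(real ^ 'n1) \<times> (real ^ 'n2) \<Rightarrow> real"
  assumes "continuous_on UNIV f1" and "continuous_on UNIV h1"
    and "continuous_on UNIV f2" and "continuous_on UNIV h2"
    and "strongly_detectable_with (state_space f1 h1 U1) N1 \<theta>1 p1"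
    and "strongly_detectable_with (state_space f2 h2 U2) N2 \<theta>2 p2"
    and "N = max N1 N2"
    and "\<theta> = max (2 * \<theta>1 / (2 * \<theta>1 + 1)) (2 * \<theta>2 / (2 * \<theta>2 + 1))"
    and "\<And>x1 x2. p (x1, x2) = (1 - \<theta>) * (p1 x1 + p2 x2)"
  shows "strongly_detectable (feedback (state_space f1 h1 U1) (state_space f2 h2 U2)) N \<and>
         strongly_detectable_with (feedback (state_space f1 h1 U1) (state_space f2 h2 U2)) N \<theta> p"
proof -
  have p: "p = (\<lambda>x. (1 - \<theta>) * (p1 (fst x) + p2 (snd x)))"
    using assms(9) by (simp add: fun_eq_iff)
  show ?thesis
    using feedback_strongly_detectable_with[OF assms(5,6,8)]
    unfolding strongly_detectable_def p assms(7) by blast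
qed

end
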